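(* Let $M=\{1^{m_1},2^{m_2},\ldots,r^{m_r}\}$ be a multiset with $n=m_1+\cdots+m_r$ and let $\mathfrak{S}_M$ be the set of all words (permutations) of $M$. The Carlitz insertion map $\psi$ described in the context is a bijection from $\mathfrak{S}_M$ to itself such that for every $\pi\in\mathfrak{S}_M$, \[ {\rm Rlmin}(\pi)={\rm Rlmin}(\psi(\pi)),\qquad ({\rm inv},{\rm rlmin})(\pi)=({\rm maj},{\rm rlmin})(\psi(\pi)). \]
   Context: For a word $w=w_1\cdots w_n$ of $M$: ${\rm inv}(w)=|\{(i,j):i<j,\ w_i>w_j\}|$, ${\rm Des}(w)=\{i\in[n-1]:w_i>w_{i+1}\}$, ${\rm des}(w)=|{\rm Des}(w)|$, ${\rm maj}(w)=\sum_{i\in{\rm Des}(w)}i$. A letter $w_i$ is a right-to-left minimum if $w_i\le w_j$ for all $j>i$ and $w_i$ is the first (leftmost) occurrence of its value in $w$; ${\rm Rlmin}(w)$ is the set of values of right-to-left minima and ${\rm rlmin}(w)=|{\rm Rlmin}(w)|$. Definition of $\psi$: given $\pi\in\mathfrak{S}_M$, label the $m_i$ copies of each letter $i$ from left to right in $\pi$ as $i_1,\dots,i_{m_i}$, and let $\pi^*=\pi^*_1\cdots\pi^*_n=1_1\cdots1_{m_1}2_1\cdots2_{m_2}\cdots r_1\cdots r_{m_r}$. Let $b_i$ be the number of letters of $\pi$ to the right of the (labelled) letter $\pi^*_i$ in $\pi$ whose value is smaller than that of $\pi^*_i$; so $I(\pi)=(b_1,\dots,b_n)$ with $0\le b_i\le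 i-1$. Build words $\alpha_1,\dots,\alpha_n$: $\alpha_1$ is the one-letter word consisting of the value of $\pi^*_1$. Given $\alpha_i$ (of length $i$), label its $i+1$ slots (before the first letter, between consecutive letters, after the last letter) as follows: the rightmost slot gets $0$; the descent slots (slots between $\alpha_i(t)>\alpha_i(t+1)$) get $1,2,\dots,{\rm des}(\alpha_i)$ from right to left; the leftmost slot gets ${\rm des}(\alpha_i)+1$; the remaining slots get ${\rm des}(\alpha_i)+2,\dots,i$ from left to right. Then $\alpha_{i+1}$ is obtained by inserting the value of $\pi^*_{i+1}$ into the slot of $\alpha_i$ labelled $b_{i+1}$. Set $\psi(\pi)=\alpha_n$. *)

theory Defs
  imports Main "HOL-Combinatorics.Multiset_Permutations"
begin

text \<open>
  Words are lists, so the letter written \<open>w\<^sub>i\<close> on paper is \<open>w ! (i - 1)\<close>. Descent positions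
  stay 1-based because their values matter for \<open>maj\<close>.
\<close>

definition word_inv :: "'a::linorder list \<Rightarrow> nat" where
  "word_inv w = card {(i, j). i < j \<and> j < length w \<and> w ! i > w ! j}"

definition Des :: "'a::linorder list \<Rightarrow> nat set" where
  "Des w = {i. 1 \<le> i \<and> i < length w \<and> w ! (i - 1) > w ! i}"

definition des :: "'a::linorder list \<Rightarrow> nat" where
  "des w = card (Des w)"

definition maj :: "'a::linorder list \<Rightarrow> nat" where
  "maj w = \<Sum> (Des w)"

definition Rlmin :: "'a::linorder list \<Rightarrow> 'a set" where
  "Rlmin w = {w ! i | i. i < length w
      \<and> (\<forall>j. i < j \<and> j < length w \<longrightarrow> w ! i \<le> w ! j) \<and> (\<forall>j<i. w ! j \<noteq> w ! i)}"

definition rlmin :: "'a::linorder list \<Rightarrow> nat" where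
  "rlmin w = card (Rlmin w)"

text \<open>
  A labelled letter of \<open>w\<close> is represented by its (0-based) position in \<open>w\<close>. Since \<open>sort_key\<close> is
  stable, equal letters keep their left-to-right order, so the sorted list of positions enumerates
  \<open>1\<^sub>1, 1\<^sub>2, \<dots>, 2\<^sub>1, 2\<^sub>2, \<dots>\<close>. The index \<open>i\<close> in the next three definitions is 1-based.
\<close>

definition star_pos :: "'a::linorder list \<Rightarrow> nat \<Rightarrow> nat" where
  "star_pos w i = sort_key (\<lambda>p. w ! p) [0..<length w] ! (i - 1)"

definition star :: "'a::linorder list \<Rightarrow> nat \<Rightarrow> 'a" where
  "star w i = w ! star_pos w i"

definition inv_code :: "'a::linorder list \<Rightarrow> nat \<Rightarrow> nat" where
  "inv_code w i = card {q. star_pos w i < q \<and> q < length w \<and> w ! q < star w i}"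

text \<open>
  Slot \<open>p\<close> of \<open>a\<close>, for \<open>p \<le> length a\<close>, is the one with exactly \<open>p\<close> letters to its left; hence slot
  \<open>p\<close> is a descent slot iff \<open>p \<in> Des a\<close>.
\<close>

definition slot_label :: "'a::linorder list \<Rightarrow> nat \<Rightarrow> nat" where
  "slot_label a p =
    (if p = length a then 0
     else if p \<in> Des a then card {q \<in> Des a. p \<le> q}
     else if p = 0 then des a + 1
     else des a + 1 + card {q. 1 \<le> q \<and> q \<le> p \<and> q \<notin> Des a})"

text \<open>
  The labels of the slots of \<open>a\<close> are exactly \<open>0, \<dots>, length a\<close>, each used once, so the description
  below is proper whenever \<open>b \<le> length a\<close>; this holds in \<open>carlitz_word\<close> because the \<open>i\<close>-th entry of
  \<open>inv_code\<close> is at most \<open>i - 1\<close>.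
\<close>

definition insert_at_label :: "'a::linorder \<Rightarrow> nat \<Rightarrow> 'a list \<Rightarrow> 'a list" where
  "insert_at_label x b a =
    (let p = (THE p. p \<le> length a \<and> slot_label a p = b) in take p a @ x # drop p a)"

text \<open>The value at \<open>0\<close> is a convention, relevant only for the empty word.\<close>

fun carlitz_word :: "'a::linorder list \<Rightarrow> nat \<Rightarrow> 'a list" where
  "carlitz_word w 0 = []"
| "carlitz_word w (Suc 0) = [star w 1]"
| "carlitz_word w (Suc (Suc i)) =
    insert_at_label (star w (Suc (Suc i))) (inv_code w (Suc (Suc i))) (carlitz_word w (Suc i))"

definition carlitz_psi :: "'a::linorder list \<Rightarrow> 'a list" where
  "carlitz_psi w = carlitz_word w (length w)"

end

theory Submission
  imports Defs
begin

text \<open>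
  Deleting the most recently inserted copy of the largest letter \<open>x\<close> must be possible without
  knowing which copy it is. Equal letters are inserted with weakly decreasing labels, and this
  keeps the following invariant: deleting the last copy of any run of \<open>x\<close> lowers \<open>maj\<close> by at
  least the last label used. Consequently the next label never points at a slot directly in front of an \<open>x\<close> (so that
  \<open>maj\<close> grows exactly by the label), and, as the drops for copies in different runs of \<open>x\<close> are
  distinct, the last inserted copy is the one with the smallest drop. Hence the label sequence can
  be recovered from \<open>\<psi>(\<pi>)\<close>. It determines \<open>\<pi>\<close>, because the first letter of \<open>\<pi>\<close> is the
  largest letter whose entry counts all the smaller letters. Finally, \<open>v\<close> is a right-to-left minimum
  iff all entries of copies of \<open>v\<close> vanish, both for \<open>\<pi>\<close> and for \<open>\<psi>(\<pi>)\<close>.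
\<close>

section \<open>Descents and slot labels of concatenations\<close>

lemma finite_Des [simp]: "finite (Des w)"
  by (simp add: Des_def)

lemma Des_append:
  "Des (u @ v) =
    Des u \<union> (if u \<noteq> [] \<and> v \<noteq> [] \<and> last u > hd v then {length u} else {}) \<union> (+) (length u) ` Des v"
  (is "_ = ?R")
proof (rule set_eqI)
  fix i
  show "i \<in> Des (u @ v) \<longleftrightarrow> i \<in> ?R"
  proof (cases "i < length u")
    case True
    then show ?thesis by (auto simp: Des_def nth_append)
  next
    case ge: False
    show ?thesis
    proof (cases "i = length u")
      case True
      have "i \<in> Des (u @ v) \<longleftrightarrow> u \<noteq> [] \<and> v \<noteq> [] \<and> last u > hd v"
        using True by (cases u; cases v) (auto simp: Des_def nth_append last_conv_nth)
      moreover have "i \<notin> Des u" "i \<notin> (+) (length u) ` Des v"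
        using True by (auto simp: Des_def)
      ultimately show ?thesis using True by auto
    next
      case False
      then obtain k where k: "i = length u + Suc k"
        using ge by (metis add_Suc_right less_imp_Suc_add linorder_neqE_nat)
      show ?thesis
        unfolding k by (auto simp: Des_def nth_append image_iff)
    qed
  qed
qed

lemma des_append:
  "des (u @ v) = des u + des v + (if u \<noteq> [] \<and> v \<noteq> [] \<and> last u > hd v then 1 else 0)"
proof -
  have "length u \<notin> Des u" "length u \<notin> (+) (length u) ` Des v"
      "Des u \<inter> (+) (length u) ` Des v = {}"
    by (auto simp: Des_def)
  then show ?thesis
    unfolding des_def Des_append by (auto simp: card_Un_disjoint card_image)
qed

text \<open>Every descent of \<open>v\<close> moves right by \<open>length u\<close>, which accounts
  for the product.\<close>

lemma maj_append:
  "maj (u @ v) = maj u + maj v + length u * des v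
    + (if u \<noteq> [] \<and> v \<noteq> [] \<and> last u > hd v then length u else 0)"
proof -
  have "length u \<notin> Des u" "length u \<notin> (+) (length u) ` Des v"
      "Des u \<inter> (+) (length u) ` Des v = {}"
    by (auto simp: Des_def)
  moreover have "\<Sum> ((+) (length u) ` Des v) = length u * des v + maj v"
    by (subst sum.reindex) (auto simp: maj_def des_def sum.distrib)
  ultimately show ?thesis
    unfolding maj_def Des_append by (auto simp: sum.union_disjoint)
qed

lemma des_Nil [simp]: "des [] = 0"
  and des_single [simp]: "des [y] = 0"
  and maj_Nil [simp]: "maj [] = 0"
  and maj_single [simp]: "maj [y] = 0"
  by (simp_all add: des_def maj_def Des_def)

lemma des_Cons: "des (y # v) = des v + (if v \<noteq> [] \<and> y > hd v then 1 else 0)"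
  using des_append[of "[y]" v] by simp

lemma maj_Cons: "maj (y # v) = maj v + des v + (if v \<noteq> [] \<and> y > hd v then 1 else 0)"
  using maj_append[of "[y]" v] by simp

lemma des_less_length: "v \<noteq> [] \<Longrightarrow> des v < length v"
  by (induction v rule: list_nonempty_induct) (auto simp: des_Cons)

text \<open>Written through the two sides of the slot, so that labels in different words can be
  compared. The last branch covers the leftmost slot as well.\<close>

definition split_label :: "'a::linorder list \<Rightarrow> 'a list \<Rightarrow> nat" where
  "split_label u v =
    (if v = [] then 0
     else if u \<noteq> [] \<and> last u > hd v then des v + 1
     else length u + des v + 1)"

lemma slot_label_append: "slot_label (u @ v) (length u) = split_label u v"
proof -
  have mem: "length u \<in> Des (u @ v) \<longleftrightarrow> u \<noteq> [] \<and> v \<noteq> [] \<and> last u > hd v"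
    by (auto simp: Des_append) (auto simp: Des_def)
  have nin: "length u \<notin> (+) (length u) ` Des v"
    by (auto simp: Des_def)
  consider "v = []" | "v \<noteq> []" "length u \<in> Des (u @ v)" | "v \<noteq> []" "u = []"
    | "v \<noteq> []" "u \<noteq> []" "length u \<notin> Des (u @ v)"
    by blast
  then show ?thesis
  proof cases
    case 1
    then show ?thesis by (simp add: slot_label_def split_label_def)
  next
    case 2
    have "{q \<in> Des (u @ v). length u \<le> q} = insert (length u) ((+) (length u) ` Des v)"
      using 2 mem by (auto simp: Des_append) (auto simp: Des_def)
    then have "card {q \<in> Des (u @ v). length u \<le> q} = des v + 1"
      using nin by (simp add: card_image des_def)
    then show ?thesis
      using 2 mem by (simp add: slot_label_def split_label_def)
  next
    case 3
    then show ?thesis by (simp add: slot_label_def split_label_def Des_def)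
  next
    case 4
    \<comment> \<open>The non-descents up to the slot number \<open>length u - des u\<close>; added
      to the offset \<open>des u + des v + 1\<close>, this cancels \<open>des u\<close>.\<close>
    have "{q. 1 \<le> q \<and> q \<le> length u \<and> q \<notin> Des (u @ v)} = {1..length u} - Des u"
      using 4 by (auto simp: Des_append split: if_splits)
    moreover have sub: "Des u \<subseteq> {1..length u}"
      by (auto simp: Des_def)
    ultimately have "card {q. 1 \<le> q \<and> q \<le> length u \<and> q \<notin> Des (u @ v)} = length u - des u"
      by (simp add: card_Diff_subset des_def)
    moreover have "des u \<le> length u"
      using card_mono[OF _ sub] by (simp add: des_def)
    ultimately show ?thesis
      using 4 mem by (simp add: slot_label_def split_label_def des_append)
  qed
qed

lemma split_label_le: "split_label u v \<le> length (u @ v)"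
  using des_less_length[of v] by (auto simp: split_label_def)

text \<open>If \<open>v\<close> is empty, only the right label is 0. If the right slot is a descent
  slot, its label is smaller, as \<open>des (s @ v)\<close> exceeds \<open>des v\<close>. Otherwise
  it is larger, as \<open>des s < length s\<close>.\<close>

lemma split_label_neq:
  assumes "s \<noteq> []"
  shows "split_label u (s @ v) \<noteq> split_label (u @ s) v"
  using assms des_less_length[OF assms] by (auto simp: split_label_def des_append)

lemma inj_on_slot_label: "inj_on (slot_label a) {..length a}"
proof (rule linorder_inj_onI')
  fix p q assume "p \<in> {..length a}" "q \<in> {..length a}" "p < q"
  define u s v where "u = take p a" and "s = take (q - p) (drop p a)" and "v = drop (q - p) (drop p a)"
  have a: "a = u @ s @ v"
    by (simp only: u_def s_def v_def append_take_drop_id)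
  have p: "p = length u" and q: "q = length (u @ s)"
    using \<open>p < q\<close> \<open>q \<in> {..length a}\<close> by (auto simp: u_def s_def)
  have "s \<noteq> []" using p q \<open>p < q\<close> by auto
  then show "slot_label a p \<noteq> slot_label a q"
    using split_label_neq[of s u v] slot_label_append[of u "s @ v"] slot_label_append[of "u @ s" v]
    unfolding a p q by simp
qed

text \<open>An injective map of the finite set \<open>{..length a}\<close> into itself is onto, so
  the slot described by \<open>THE\<close> exists and is unique.\<close>

lemma insert_at_label_split:
  assumes "b \<le> length a"
  obtains u v where "a = u @ v" "split_label u v = b" "insert_at_label x b a = u @ x # v"
proof -
  have "slot_label a ` {..length a} \<subseteq> {..length a}"
  proof (rule image_subsetI)
    fix p assume "p \<in> {..length a}"
    then show "slot_label a p \<in> {..length a}"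
      using slot_label_append[of "take p a" "drop p a"] split_label_le[of "take p a" "drop p a"]
      by simp
  qed
  then have "slot_label a ` {..length a} = {..length a}"
    by (intro endo_inj_surj inj_on_slot_label) auto
  then obtain p where p: "p \<le> length a" "slot_label a p = b"
    using assms by (metis (no_types, lifting) atMost_iff imageE)
  then have "(THE p. p \<le> length a \<and> slot_label a p = b) = p"
    by (intro the_equality) (auto dest: inj_onD[OF inj_on_slot_label])
  then show ?thesis
    using p slot_label_append[of "take p a" "drop p a"]
    by (intro that[of "take p a" "drop p a"]) (auto simp: insert_at_label_def)
qed

section \<open>Inserting a largest letter\<close>

text \<open>For nonempty \<open>v\<close>, the new letter makes a descent at
  \<open>length u + 1\<close>, shifts the \<open>des v\<close> descents of \<open>v\<close> by one,
  and destroys a descent at \<open>length u\<close> if there was one. A letter \<open>x\<close> at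
  the head of \<open>v\<close> would prevent the new descent.\<close>

lemma maj_insert:
  assumes "\<forall>y\<in>set (u @ v). y \<le> x" and "v \<noteq> [] \<Longrightarrow> hd v \<noteq> x"
  shows "maj (u @ x # v) = maj (u @ v) + split_label u v"
proof -
  have "\<not> x < last u" if "u \<noteq> []"
    using assms that by (auto simp: not_less)
  moreover have "hd v < x" if "v \<noteq> []"
    using assms that by (simp add: order_less_le)
  ultimately show ?thesis
    by (auto simp: maj_append maj_Cons des_Cons split_label_def)
qed

text \<open>If \<open>v\<close> does not begin with \<open>x\<close>, then \<open>split_label u v\<close> is the drop of \<open>maj\<close> when \<open>x\<close> is
  deleted from \<open>u @ x # v\<close>; the copies of \<open>x\<close> inside a run are included because the invariant is preserved
  more simply that way.\<close>

definition removal_ge :: "nat \<Rightarrow> 'a::linorder \<Rightarrow> 'a list \<Rightarrow> bool" where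
  "removal_ge b x a \<longleftrightarrow> (\<forall>u v. a = u @ x # v \<longrightarrow> b \<le> split_label u v)"

text \<open>The induction moves to the last copy of the run. Another \<open>x\<close> precedes it,
  so deleting it leaves a descent slot or the end of the word, and the bound there is the number of
  descents from that copy on, which is constant along the run.\<close>

lemma removal_ge_run:
  assumes "removal_ge b x (u @ x # x # v)" and "\<forall>y\<in>set v. y \<le> x"
  shows "b \<le> des (x # v)"
  using assms
proof (induction v arbitrary: u)
  case Nil
  then show ?case
    unfolding removal_ge_def by (force dest: spec[of _ "u @ [x]"] simp: split_label_def)
next
  case (Cons y v)
  show ?case
  proof (cases "y = x")
    case True
    then show ?thesis
      using Cons.IH[of "u @ [x]"] Cons.prems by (simp add: des_Cons)
  next
    case False
    have "b \<le> split_label (u @ [x]) (y # v)"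
      using Cons.prems(1) unfolding removal_ge_def by simp
    then show ?thesis
      using False Cons.prems(2) by (auto simp: split_label_def des_Cons split: if_splits)
  qed
qed

text \<open>A slot directly before \<open>x\<close> is not a descent slot, so its label is large.
  The label obtained by deleting that \<open>x\<close>, or the last copy of its run, is strictly
  smaller, against the invariant.\<close>

lemma removal_ge_not_before:
  assumes ge: "removal_ge b x (u @ v)" and le: "\<forall>y\<in>set (u @ v). y \<le> x"
    and b: "split_label u v = b" and v: "v \<noteq> []"
  shows "hd v < x"
proof (rule ccontr)
  assume "\<not> hd v < x"
  then obtain w where w: "v = x # w"
    using v le by (cases v) auto
  have "\<not> x < last u" if "u \<noteq> []"
    using le that by (auto simp: not_less)
  then have lab: "b = length u + des (x # w) + 1"
    using b by (auto simp: split_label_def w)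
  have lw: "b \<le> split_label u w"
    using ge unfolding removal_ge_def w by blast
  show False
  proof (cases w)
    case Nil
    then show ?thesis using lw lab by (simp add: split_label_def)
  next
    case (Cons y t)
    show ?thesis
    proof (cases "y = x")
      case True
      then show ?thesis
        using removal_ge_run[of b x u t] ge le lab w Cons by (simp add: des_Cons)
    next
      case False
      then show ?thesis
        using lw lab le w Cons by (auto simp: split_label_def des_Cons split: if_splits)
    qed
  qed
qed

text \<open>The new copy itself has drop exactly \<open>b\<close>. For a copy to its left the part
  on the right loses no descents; for a copy to its right the part on the left only gets
  longer.\<close>

lemma removal_ge_insert:
  assumes ge: "removal_ge b x (u @ v)" and le: "\<forall>y\<in>set (u @ v). y \<le> x"
    and b: "split_label u v = b" and v: "v \<noteq> [] \<Longrightarrow> hd v < x"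
  shows "removal_ge b x (u @ x # v)"
  unfolding removal_ge_def
proof (intro allI impI)
  fix u' v' assume eq: "u @ x # v = u' @ x # v'"
  then consider "u' = u" "v' = v"
    | s where "u = u' @ x # s" "v' = s @ x # v"
    | s where "u' = u @ x # s" "v = s @ x # v'"
    by (auto simp: append_eq_append_conv2 Cons_eq_append_conv append_eq_Cons_conv)
  then show "b \<le> split_label u' v'"
  proof cases
    case 1
    then show ?thesis using b by simp
  next
    case 2
    have "b \<le> split_label u' (s @ v)"
      using ge unfolding removal_ge_def 2 by simp
    also have "\<dots> \<le> split_label u' (s @ x # v)"
    proof (cases "s = []")
      case True
      have "\<not> x < last u'" if "u' \<noteq> []"
        using le that 2 by (auto simp: not_less)
      then show ?thesis
        using v True by (auto simp: split_label_def des_Cons)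
    next
      case False
      have "\<not> x < last s"
        using le False 2 by (auto simp: not_less)
      then have "des (s @ v) \<le> des (s @ x # v)"
        using v by (auto simp: des_append des_Cons)
      then show ?thesis
        using False by (auto simp: split_label_def)
    qed
    finally show ?thesis using 2 by simp
  next
    case 3
    \<comment> \<open>Otherwise \<open>v\<close> would begin with \<open>x\<close>. A nonempty
      \<open>s\<close> keeps the letter before the slot unchanged.\<close>
    have "s \<noteq> []" using v 3 by auto
    have "b \<le> split_label (u @ s) v'"
      using ge unfolding removal_ge_def 3 by (metis append.assoc)
    also have "\<dots> \<le> split_label (u @ x # s) v'"
      using \<open>s \<noteq> []\<close> by (auto simp: split_label_def)
    finally show ?thesis using 3 by simp
  qed
qed

text \<open>Counterpart of \<open>split_label_neq\<close> for deleting one of two copies of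
  \<open>x\<close> from \<open>u @ x # s @ x # v\<close>; the same comparison of
  \<open>des s\<close> with \<open>length s\<close> decides it.\<close>

lemma split_label_neq_removal:
  assumes "\<forall>y\<in>set s. y \<le> x" and "s \<noteq> []" and "v \<noteq> [] \<Longrightarrow> hd v < x"
  shows "split_label u (s @ x # v) \<noteq> split_label (u @ x # s) v"
proof -
  have "\<not> x < last s"
    using assms by (auto simp: not_less)
  then have "des (s @ x # v) = des s + des v + (if v \<noteq> [] then 1 else 0)"
    using assms by (auto simp: des_append des_Cons)
  moreover have "des s < length s"
    using assms by (intro des_less_length)
  ultimately show ?thesis
    using assms(2) by (auto simp: split_label_def)
qed

text \<open>Each label is a lower bound for the other, so they coincide, while copies in different
  runs have different drops. Copies with nothing between them are excluded because neither
  \<open>v\<close> nor \<open>v'\<close> begins with \<open>x\<close>.\<close>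

lemma last_insertion_unique:
  assumes eq: "u @ x # v = u' @ x # v'"
    and le: "\<forall>y\<in>set (u @ x # v). y \<le> x"
    and ge: "removal_ge (split_label u v) x (u @ x # v)"
    and ge': "removal_ge (split_label u' v') x (u @ x # v)"
    and v: "v \<noteq> [] \<Longrightarrow> hd v < x" and v': "v' \<noteq> [] \<Longrightarrow> hd v' < x"
  shows "u = u' \<and> v = v'"
proof -
  have lab: "split_label u v = split_label u' v'"
    using ge ge' eq unfolding removal_ge_def by (simp add: order_antisym)
  consider "u' = u" "v' = v"
    | s where "u = u' @ x # s" "v' = s @ x # v"
    | s where "u' = u @ x # s" "v = s @ x # v'"
    using eq by (auto simp: append_eq_append_conv2 Cons_eq_append_conv append_eq_Cons_conv)
  then show ?thesis
  proof cases
    case 2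
    then show ?thesis
      using split_label_neq_removal[of s x v u'] le lab v v' by (cases "s = []") auto
  next
    case 3
    then show ?thesis
      using split_label_neq_removal[of s x v' u] le lab v v' by (cases "s = []") auto
  qed auto
qed

section \<open>Words built from label sequences\<close>

text \<open>Among equal letters the labels decrease weakly because an earlier copy in a word has at
  least as many smaller letters to its right.\<close>

definition before :: "'a::linorder \<times> nat \<Rightarrow> 'a \<times> nat \<Rightarrow> bool" where
  "before c d \<longleftrightarrow> fst c < fst d \<or> fst c = fst d \<and> snd d \<le> snd c"

definition admissible :: "('a::linorder \<times> nat) list \<Rightarrow> bool" where
  "admissible cs \<longleftrightarrow> sorted_wrt before cs \<and> (\<forall>i<length cs. snd (cs ! i) \<le> i)"

definition build :: "('a::linorder \<times> nat) list \<Rightarrow> 'a list" where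
  "build = foldl (\<lambda>a (x, b). insert_at_label x b a) []"

lemma build_Nil [simp]: "build [] = []"
  and build_snoc [simp]: "build (cs @ [(x, b)]) = insert_at_label x b (build cs)"
  by (simp_all add: build_def)

lemma admissible_snoc:
  "admissible (cs @ [c]) \<longleftrightarrow> admissible cs \<and> (\<forall>d\<in>set cs. before d c) \<and> snd c \<le> length cs"
  by (auto simp: admissible_def sorted_wrt_append nth_append less_Suc_eq)

lemma mset_build: "admissible cs \<Longrightarrow> mset (build cs) = mset (map fst cs)"
proof (induction cs rule: rev_induct)
  case (snoc c cs)
  obtain x b where c: "c = (x, b)" by force
  have IH: "mset (build cs) = mset (map fst cs)" and "b \<le> length cs"
    using snoc by (auto simp: admissible_snoc c)
  moreover have "length (build cs) = length cs"
    using IH by (metis length_map mset_eq_length)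
  ultimately obtain u v where "build cs = u @ v" "build (cs @ [c]) = u @ x # v"
    using insert_at_label_split[of b "build cs" x] by (metis build_snoc c)
  then show ?case
    using IH by (simp add: c)
qed simp

lemma length_build: "admissible cs \<Longrightarrow> length (build cs) = length cs"
  using mset_build by (metis length_map mset_eq_length)

lemma set_build: "admissible cs \<Longrightarrow> set (build cs) = fst ` set cs"
  using mset_build by (metis set_map set_mset_mset)

lemma build_le:
  assumes "admissible cs" "\<forall>d\<in>set cs. before d (x, b)"
  shows "\<forall>y\<in>set (build cs). y \<le> x"
  using assms by (auto simp: set_build before_def less_imp_le)

lemma insert_split:
  assumes "\<forall>y\<in>set a. y \<le> x" "removal_ge b x a" "b \<le> length a"
  obtains u v where "a = u @ v" "split_label u v = b" "insert_at_label x b a = u @ x # v"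
    "v \<noteq> [] \<Longrightarrow> hd v < x" "removal_ge b x (u @ x # v)"
proof -
  obtain u v where uv: "a = u @ v" "split_label u v = b" "insert_at_label x b a = u @ x # v"
    using insert_at_label_split assms(3) by metis
  moreover have "hd v < x" if "v \<noteq> []"
    using removal_ge_not_before assms uv that by metis
  ultimately show ?thesis
    using removal_ge_insert that assms by metis
qed

text \<open>If the last letter is also \<open>x\<close>, its label \<open>d\<close> is at least
  \<open>b\<close>, and the invariant for \<open>d\<close> survives the insertion. Otherwise
  \<open>x\<close> is larger than all letters and the claim is vacuous.\<close>

lemma build_removal_ge:
  "admissible cs \<Longrightarrow> \<forall>d\<in>set cs. before d (x, b) \<Longrightarrow> removal_ge b x (build cs)"
proof (induction cs arbitrary: x b rule: rev_induct)
  case Nil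
  then show ?case by (simp add: removal_ge_def)
next
  case (snoc c cs)
  obtain y d where c: "c = (y, d)" by force
  have adm: "admissible cs" and bef: "\<forall>e\<in>set cs. before e (y, d)" and d: "d \<le> length cs"
    using snoc.prems by (auto simp: admissible_snoc c)
  have xy: "before (y, d) (x, b)"
    using snoc.prems(2) by (simp add: c)
  show ?case
  proof (cases "y = x")
    case True
    then have "b \<le> d" using xy by (simp add: before_def)
    obtain u v where "insert_at_label y d (build cs) = u @ y # v" "removal_ge d y (u @ y # v)"
      using insert_split build_le[OF adm bef] snoc.IH[OF adm bef] d length_build[OF adm] by metis
    then show ?thesis
      using True \<open>b \<le> d\<close> unfolding removal_ge_def c build_snoc by (metis order_trans)
  next
    case False
    then have "x \<notin> set (build (cs @ [c]))"
      unfolding set_build[OF snoc.prems(1)] using bef xy by (auto simp: before_def c)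
    then show ?thesis
      by (auto simp: removal_ge_def)
  qed
qed

text \<open>One insertion step, packaged for the inductions on \<open>maj\<close>, on injectivity
  and on right-to-left minima.\<close>

lemma build_snocE:
  assumes "admissible (cs @ [(x, b)])"
  obtains u v where "build cs = u @ v" "split_label u v = b" "build (cs @ [(x, b)]) = u @ x # v"
    "v \<noteq> [] \<Longrightarrow> hd v < x" "removal_ge b x (u @ x # v)" "\<forall>y\<in>set (u @ v). y \<le> x"
proof -
  have adm: "admissible cs" and bef: "\<forall>e\<in>set cs. before e (x, b)" and b: "b \<le> length cs"
    using assms by (auto simp: admissible_snoc)
  show ?thesis
    using insert_split[of "build cs" x b] build_le[OF adm bef] build_removal_ge[OF adm bef] b
      length_build[OF adm] that by (metis build_snoc)
qed

lemma maj_build: "admissible cs \<Longrightarrow> maj (build cs) = sum_list (map snd cs)"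
proof (induction cs rule: rev_induct)
  case (snoc c cs)
  obtain x b where c: "c = (x, b)" by force
  obtain u v where "build cs = u @ v" "split_label u v = b" "build (cs @ [(x, b)]) = u @ x # v"
    "v \<noteq> [] \<Longrightarrow> hd v < x" "\<forall>y\<in>set (u @ v). y \<le> x"
    using build_snocE snoc.prems unfolding c by metis
  then show ?case
    using snoc maj_insert[of u v x] by (auto simp: c admissible_snoc)
qed simp

lemma build_inject:
  assumes "admissible cs" "admissible ds" "map fst cs = map fst ds" "build cs = build ds"
  shows "cs = ds"
  using assms
proof (induction cs arbitrary: ds rule: rev_induct)
  case (snoc c cs)
  obtain x b where c: "c = (x, b)" by force
  obtain es d where ds: "ds = es @ [(x, d)]" and es: "map fst cs = map fst es"
    using snoc.prems(3) by (cases ds rule: rev_cases) (auto simp: c)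
  obtain u v where 1: "build cs = u @ v" "split_label u v = b" "build (cs @ [(x, b)]) = u @ x # v"
    "v \<noteq> [] \<Longrightarrow> hd v < x" "removal_ge b x (u @ x # v)" "\<forall>y\<in>set (u @ v). y \<le> x"
    using build_snocE snoc.prems(1) unfolding c by metis
  obtain u' v' where 2: "build es = u' @ v'" "split_label u' v' = d"
    "build (es @ [(x, d)]) = u' @ x # v'"
    "v' \<noteq> [] \<Longrightarrow> hd v' < x" "removal_ge d x (u' @ x # v')" "\<forall>y\<in>set (u' @ v'). y \<le> x"
    using build_snocE snoc.prems(2) unfolding ds by metis
  have eq: "u @ x # v = u' @ x # v'"
    using snoc.prems(4) 1(3) 2(3) by (simp add: c ds)
  \<comment> \<open>Both last labels satisfy the invariant on the same word, which forces the same
    slot; hence the shorter words agree too.\<close>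
  have same: "u = u' \<and> v = v'"
    by (rule last_insertion_unique[OF eq]) (use 1 2 eq in auto)
  moreover have "cs = es"
    using snoc.IH[of es] snoc.prems(1,2) es 1(1) 2(1) same
    unfolding c ds admissible_snoc by simp
  ultimately show ?case
    using 1(2) 2(2) by (simp add: c ds)
qed simp

section \<open>The inversion code\<close>

text \<open>The entries in the order of the word itself, which permits recursion on the word;
  sorting by letters is postponed to \<open>code_seq\<close>.\<close>

fun enc :: "'a::linorder list \<Rightarrow> ('a \<times> nat) list" where
  "enc [] = []"
| "enc (y # w) = (y, length (filter (\<lambda>z. z < y) w)) # enc w"

lemma length_enc [simp]: "length (enc w) = length w"
  and map_fst_enc [simp]: "map fst (enc w) = w"
  by (induction w) auto

lemma enc_le: "(z, c) \<in> set (enc w) \<Longrightarrow> c \<le> length (filter (\<lambda>y. y < z) w)"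
  by (induction w) auto

lemma card_less_nth: "card {q. q < length w \<and> w ! q < y} = length (filter (\<lambda>z. z < y) w)"
  by (simp add: length_filter_conv_card)

lemma enc_nth:
  "p < length w \<Longrightarrow> enc w ! p = (w ! p, card {q. p < q \<and> q < length w \<and> w ! q < w ! p})"
proof (induction w arbitrary: p)
  case (Cons y w)
  have *: "{q. p < q \<and> q < length (y # w) \<and> (y # w) ! q < (y # w) ! p}
      = Suc ` {q. p \<le> q \<and> q < length w \<and> w ! q < (y # w) ! p}"
  proof (intro set_eqI iffI)
    fix q assume "q \<in> {q. p < q \<and> q < length (y # w) \<and> (y # w) ! q < (y # w) ! p}"
    then show "q \<in> Suc ` {q. p \<le> q \<and> q < length w \<and> w ! q < (y # w) ! p}"
      by (cases q) auto
  qed auto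
  show ?case
  proof (cases p)
    case 0
    then show ?thesis
      unfolding * by (simp add: card_image card_less_nth)
  next
    case (Suc k)
    then show ?thesis
      using Cons unfolding * by (simp add: card_image Suc_le_eq)
  qed
qed simp

lemma word_inv_Cons: "word_inv (y # w) = length (filter (\<lambda>z. z < y) w) + word_inv w"
proof -
  let ?I = "{(i, j). i < j \<and> j < length w \<and> w ! i > w ! j}"
  let ?J = "{q. q < length w \<and> w ! q < y}"
  have fin: "finite ?I"
    by (rule finite_subset[of _ "{..<length w} \<times> {..<length w}"]) auto
  have "{(i, j). i < j \<and> j < length (y # w) \<and> (y # w) ! i > (y # w) ! j}
      = (\<lambda>q. (0, Suc q)) ` ?J \<union> map_prod Suc Suc ` ?I" (is "?L = ?R")
  proof (intro set_eqI iffI)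
    fix ij assume "ij \<in> ?L"
    then obtain i j where "ij = (i, Suc j)" "i < Suc j" "j < length w" "(y # w) ! i > w ! j"
      by (auto simp: less_Suc_eq_0_disj gr0_conv_Suc)
    then show "ij \<in> ?R"
      by (cases i) (auto simp: image_iff)
  qed auto
  moreover have "card (map_prod Suc Suc ` ?I) = word_inv w"
    unfolding word_inv_def by (rule card_image) (auto simp: inj_on_def)
  moreover have "card ((\<lambda>q. (0::nat, Suc q)) ` ?J) = length (filter (\<lambda>z. z < y) w)"
    by (subst card_image) (auto simp: inj_on_def card_less_nth)
  ultimately show ?thesis
    using fin card_Un_disjoint[of "(\<lambda>q. (0, Suc q)) ` ?J" "map_prod Suc Suc ` ?I"]
    by (auto simp: word_inv_def[of "y # w"])
qed

lemma word_inv_eq_sum: "word_inv w = sum_list (map snd (enc w))"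
  by (induction w) (simp_all add: word_inv_Cons, simp add: word_inv_def)

lemma mset_enc_inject: "mset (enc w) = mset (enc w') \<Longrightarrow> w = w'"
proof (induction w arbitrary: w')
  case Nil
  then show ?case by (metis length_0_conv length_enc mset_eq_length)
next
  case (Cons y w)
  then obtain z t where w': "w' = z # t"
    by (cases w') auto
  have m: "mset (y # w) = mset (z # t)"
    using arg_cong[OF Cons.prems, of "image_mset fst"] unfolding w'
    by (simp flip: mset_map)
  \<comment> \<open>The entry of a head \<open>z\<close> counts all letters below \<open>z\<close>.
    In \<open>y # w\<close> with \<open>y < z\<close> such an entry would lie in the tail, where the
    count misses \<open>y\<close>.\<close>
  have head: "\<not> y < z" if "mset (enc (y # w)) = mset (enc (z # t))" "mset (y # w) = mset (z # t)"
    for y z :: 'a and w t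
  proof
    assume "y < z"
    let ?c = "length (filter (\<lambda>x. x < z) t)"
    have "(z, ?c) \<in> set (enc (y # w))"
      using that(1) by (metis enc.simps(2) list.set_intros(1) mset_eq_setD)
    then have "?c \<le> length (filter (\<lambda>x. x < z) w)"
      using \<open>y < z\<close> by (auto dest: enc_le)
    moreover have "length (filter (\<lambda>x. x < z) (z # t)) = length (filter (\<lambda>x. x < z) (y # w))"
      using that(2) by (metis mset_eq_length mset_filter)
    ultimately show False using \<open>y < z\<close> by simp
  qed
  have "y = z"
    using head[of y w z t] head[of z t y w] Cons.prems m unfolding w' by (metis linorder_neqE)
  \<comment> \<open>The tails have the same letters, so the heads carry the same entry, which
    cancels.\<close>
  moreover from this have "mset (enc w) = mset (enc t)"
    using Cons.prems m unfolding w'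
    by (metis (no_types, lifting) add_mset_add_single add_right_imp_eq enc.simps(2) mset.simps(2)
        mset_eq_length mset_filter)
  ultimately show ?case
    using Cons.IH w' by blast
qed

section \<open>The code in sorted order, and Carlitz insertion as \<open>build\<close>\<close>

definition code_seq :: "'a::linorder list \<Rightarrow> ('a \<times> nat) list" where
  "code_seq w = sort_key fst (enc w)"

lemma insort_key_map: "insort_key f (g x) (map g xs) = map g (insort_key (\<lambda>x. f (g x)) x xs)"
  by (induction xs) auto

lemma sort_key_map: "sort_key f (map g xs) = map g (sort_key (\<lambda>x. f (g x)) xs)"
  by (induction xs) (auto simp: insort_key_map)

lemma map_fst_code_seq: "map fst (code_seq w) = sort w"
  using sort_key_map[of "\<lambda>x. x" fst "enc w"] by (simp add: code_seq_def)

text \<open>\<open>enc w\<close> is an image of the list of positions, and sorting by the letter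
  commutes with that map, ties included.\<close>

lemma code_seq_nth:
  assumes "i < length w"
  shows "code_seq w ! i = (star w (Suc i), inv_code w (Suc i))"
proof -
  have "enc w = map (\<lambda>p. (w ! p, card {q. p < q \<and> q < length w \<and> w ! q < w ! p})) [0..<length w]"
    by (rule nth_equalityI) (simp_all add: enc_nth)
  then show ?thesis
    using assms by (simp add: code_seq_def sort_key_map star_def inv_code_def star_pos_def)
qed

text \<open>\<open>insort_key\<close> puts the new pair in front of those with the same letter, so
  its label must be at least theirs.\<close>

lemma sorted_wrt_insort_before:
  assumes "sorted_wrt before cs" "\<forall>d\<in>set cs. fst d = fst c \<longrightarrow> snd d \<le> snd c"
  shows "sorted_wrt before (insort_key fst c cs)"
  using assms
  by (induction cs) (auto simp: before_def set_insort_key not_le intro: order_le_neq_trans less_trans)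

lemma admissible_code_seq: "admissible (code_seq w)"
  unfolding admissible_def
proof (intro conjI allI impI)
  show sorted: "sorted_wrt before (code_seq w)"
    unfolding code_seq_def
  proof (induction w)
    case (Cons y w)
    then show ?case
      by (auto intro!: sorted_wrt_insort_before dest: enc_le)
  qed simp
  fix i assume i: "i < length (code_seq w)"
  obtain y b where yb: "code_seq w ! i = (y, b)" by force
  \<comment> \<open>The entry is at most the number of letters below \<open>y\<close>, and in the
    sorted list these all stand before index \<open>i\<close>.\<close>
  then have "b \<le> length (filter (\<lambda>z. z < y) w)"
    using i enc_le[of y b w] by (metis code_seq_def nth_mem set_sort)
  also have "\<dots> = length (filter (\<lambda>z. z < y) (map fst (code_seq w)))"
    unfolding map_fst_code_seq by (metis mset_eq_length mset_filter mset_sort)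
  also have "\<dots> = card {j. j < length (code_seq w) \<and> fst (code_seq w ! j) < y}"
    unfolding length_filter_conv_card by (rule arg_cong[of _ _ card]) auto
  also have "\<dots> \<le> card {..<i}"
  proof (rule card_mono)
    show "{j. j < length (code_seq w) \<and> fst (code_seq w ! j) < y} \<subseteq> {..<i}"
    proof safe
      fix j assume j: "j < length (code_seq w)" "fst (code_seq w ! j) < y"
      show "j < i"
      proof (rule ccontr)
        assume "\<not> j < i"
        then consider "j = i" | "i < j" by linarith
        then show False
          using sorted_wrt_nth_less[OF sorted] j yb by cases (force simp: before_def)+
      qed
    qed
  qed simp
  finally show "snd (code_seq w ! i) \<le> i"
    by (simp add: yb)
qed

lemma carlitz_psi_eq_build: "carlitz_psi w = build (code_seq w)"
proof -
  have len: "length (code_seq w) = length w" for w :: "'a list"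
    by (simp add: code_seq_def)
  have "carlitz_word w i = build (take i (code_seq w))" if "i \<le> length w" for i
    using that
  proof (induction w i rule: carlitz_word.induct)
    case (2 w)
    \<comment> \<open>\<open>carlitz_word\<close> starts from a one-letter word,
      \<open>build\<close> from the empty one; they agree because admissibility forces the first
      label to be 0.\<close>
    have "snd (code_seq w ! 0) \<le> 0"
      using admissible_code_seq[of w] 2 len[of w] unfolding admissible_def
      by (auto simp: Suc_le_eq dest!: spec[of _ 0])
    then have "inv_code w (Suc 0) = 0"
      using 2 code_seq_nth[of 0 w] by (simp add: Suc_le_eq)
    moreover have "insert_at_label x 0 [] = [x]" for x :: 'a
      by (rule insert_at_label_split[of 0 "[]" x]) auto
    ultimately have "build [(star w (Suc 0), inv_code w (Suc 0))] = [star w (Suc 0)]"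
      by (simp add: build_def)
    then show ?case
      using 2 code_seq_nth[of 0 w] len[of w] by (simp add: take_Suc_conv_app_nth Suc_le_eq)
  next
    case (3 w i)
    then have "take (Suc (Suc i)) (code_seq w)
        = take (Suc i) (code_seq w) @ [(star w (Suc (Suc i)), inv_code w (Suc (Suc i)))]"
      using code_seq_nth[of "Suc i" w] by (subst take_Suc_conv_app_nth) (simp_all add: code_seq_def)
    then show ?case
      using 3 by (metis Suc_leD build_snoc carlitz_word.simps(3))
  qed simp
  then show ?thesis
    by (simp add: carlitz_psi_def len)
qed

section \<open>Right-to-left minima\<close>

text \<open>For a letter of \<open>w\<close> it is equivalent to impose the condition on all its occurrences or only
  on the first one, as \<^const>\<open>Rlmin\<close> does.\<close>

fun no_smaller_after :: "'a::linorder \<Rightarrow> 'a list \<Rightarrow> bool" where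
  "no_smaller_after v [] \<longleftrightarrow> True"
| "no_smaller_after v (y # w) \<longleftrightarrow> (y = v \<longrightarrow> (\<forall>z\<in>set w. v \<le> z)) \<and> no_smaller_after v w"

lemma no_smaller_after_append:
  "no_smaller_after v (s @ t) \<longleftrightarrow>
    no_smaller_after v s \<and> no_smaller_after v t \<and> (v \<in> set s \<longrightarrow> (\<forall>z\<in>set t. v \<le> z))"
  by (induction s) auto

lemma Rlmin_eq: "Rlmin w = {v \<in> set w. no_smaller_after v w}"
proof (intro set_eqI iffI)
  fix v assume "v \<in> Rlmin w"
  then obtain i where i: "v = w ! i" "i < length w"
      "\<forall>j. i < j \<and> j < length w \<longrightarrow> w ! i \<le> w ! j" "\<forall>j<i. w ! j \<noteq> w ! i"
    by (auto simp: Rlmin_def)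
  have w: "w = take i w @ v # drop (Suc i) w"
    using i by (simp add: id_take_nth_drop)
  have "v \<notin> set (take i w)"
    using i by (auto simp: in_set_conv_nth)
  moreover have "no_smaller_after v s" if "v \<notin> set s" for s
    using that by (induction s) auto
  moreover have ge: "\<forall>z\<in>set (drop (Suc i) w). v \<le> z"
    using i by (auto simp: in_set_conv_nth)
  moreover have "no_smaller_after v s" if "\<forall>z\<in>set s. v \<le> z" for s
    using that by (induction s) auto
  ultimately have "no_smaller_after v (take i w @ v # drop (Suc i) w)"
    by (simp add: no_smaller_after_append)
  then show "v \<in> {v \<in> set w. no_smaller_after v w}"
    using i w by (metis (mono_tags, lifting) mem_Collect_eq nth_mem)
next
  fix v assume v: "v \<in> {v \<in> set w. no_smaller_after v w}"
  then obtain s t where w: "w = s @ v # t" "v \<notin> set s"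
    by (auto dest: split_list_first)
  then have "\<forall>z\<in>set t. v \<le> z"
    using v by (simp add: no_smaller_after_append)
  then show "v \<in> Rlmin w"
    unfolding Rlmin_def using w
    by (auto simp: nth_append intro!: exI[of _ "length s"] nth_mem)
qed

lemma no_smaller_after_enc: "no_smaller_after v w \<longleftrightarrow> (\<forall>b. (v, b) \<in> set (enc w) \<longrightarrow> b = 0)"
  by (induction w) (auto simp: filter_empty_conv not_less)

text \<open>A copy of \<open>v\<close> with label 0 goes to the end; with any other label it is
  followed by \<open>hd t\<close>, which is smaller. Later letters are at least \<open>v\<close>, so
  larger ones change nothing.\<close>

lemma no_smaller_after_build:
  "admissible cs \<Longrightarrow> no_smaller_after v (build cs) \<longleftrightarrow> (\<forall>b. (v, b) \<in> set cs \<longrightarrow> b = 0)"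
proof (induction cs rule: rev_induct)
  case (snoc c cs)
  obtain x b where c: "c = (x, b)" by force
  obtain s t where st: "build cs = s @ t" "split_label s t = b" "build (cs @ [(x, b)]) = s @ x # t"
    "t \<noteq> [] \<Longrightarrow> hd t < x" "\<forall>y\<in>set (s @ t). y \<le> x"
    using build_snocE snoc.prems unfolding c by metis
  have IH: "no_smaller_after v (s @ t) \<longleftrightarrow> (\<forall>b. (v, b) \<in> set cs \<longrightarrow> b = 0)"
    using snoc st(1) by (simp add: admissible_snoc)
  have b0: "b = 0 \<longleftrightarrow> t = []"
    using st(2) by (auto simp: split_label_def split: if_splits)
  consider "v < x" | "v = x" | "x < v" by force
  then show ?case
  proof cases
    case 1
    then have "no_smaller_after v (s @ x # t) \<longleftrightarrow> no_smaller_after v (s @ t)"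
      by (auto simp: no_smaller_after_append)
    then show ?thesis
      using IH st 1 by (auto simp: c)
  next
    case 2
    have "no_smaller_after x (s @ x # t) \<longleftrightarrow> no_smaller_after x (s @ t) \<and> t = []"
      using st(4) by (cases t) (auto simp: no_smaller_after_append)
    then show ?thesis
      using IH st 2 b0 by (auto simp: c)
  next
    case 3
    \<comment> \<open>All letters so far are below \<open>v\<close>, so both sides hold
      vacuously.\<close>
    have "no_smaller_after v a" if "\<forall>y\<in>set a. y < v" for a
      using that by (induction a) auto
    moreover have "\<forall>y\<in>set (s @ x # t). y < v" "\<forall>y\<in>set (s @ t). y < v"
      using st(5) 3 by (auto intro: le_less_trans)
    ultimately show ?thesis
      using IH st 3 by (auto simp: c)
  qed
qed simp

section \<open>Properties of the Carlitz insertion map\<close>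

lemma mset_carlitz_psi: "mset (carlitz_psi w) = mset w"
  by (simp add: carlitz_psi_eq_build mset_build admissible_code_seq map_fst_code_seq flip: mset_map)

lemma maj_carlitz_psi: "maj (carlitz_psi w) = word_inv w"
proof -
  have "sum_list (map snd (code_seq w)) = sum_list (map snd (enc w))"
    by (metis code_seq_def mset_map mset_sort sum_mset_sum_list)
  then show ?thesis
    by (simp add: carlitz_psi_eq_build maj_build admissible_code_seq word_inv_eq_sum)
qed

lemma Rlmin_carlitz_psi: "Rlmin (carlitz_psi w) = Rlmin w"
proof -
  have "set (carlitz_psi w) = set w"
    by (rule mset_eq_setD[OF mset_carlitz_psi])
  moreover have "no_smaller_after v (carlitz_psi w) \<longleftrightarrow> no_smaller_after v w" for v
    using no_smaller_after_build[OF admissible_code_seq, of v w] no_smaller_after_enc[of v w]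
    by (simp add: carlitz_psi_eq_build code_seq_def)
  ultimately show ?thesis
    by (simp add: Rlmin_eq)
qed

text \<open>Equal multisets give the equal letter sequences required by \<open>build_inject\<close>;
  \<open>mset_enc_inject\<close> then restores the order of the word.\<close>

lemma carlitz_psi_inject:
  assumes "mset w = mset w'" "carlitz_psi w = carlitz_psi w'"
  shows "w = w'"
proof -
  have "map fst (code_seq w) = map fst (code_seq w')"
    unfolding map_fst_code_seq using assms(1) by (metis properties_for_sort mset_sort sorted_sort)
  then have "code_seq w = code_seq w'"
    using assms(2) by (intro build_inject admissible_code_seq) (simp_all add: carlitz_psi_eq_build)
  then have "mset (enc w) = mset (enc w')"
    by (metis code_seq_def mset_sort)
  then show ?thesis
    by (rule mset_enc_inject)
qed

theorem theorem3p3: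
  fixes r :: nat and m :: "nat \<Rightarrow> nat" and M :: "nat multiset"
  assumes "M = (\<Sum>i\<in>{1..r}. replicate_mset (m i) i)"
  shows "bij_betw carlitz_psi (permutations_of_multiset M) (permutations_of_multiset M)
    \<and> (\<forall>\<pi> \<in> permutations_of_multiset M.
          Rlmin \<pi> = Rlmin (carlitz_psi \<pi>)
        \<and> (word_inv \<pi>, rlmin \<pi>) = (maj (carlitz_psi \<pi>), rlmin (carlitz_psi \<pi>)))"
proof -
  let ?S = "permutations_of_multiset M"
  have inj: "inj_on carlitz_psi ?S"
    by (auto intro!: inj_onI carlitz_psi_inject simp: permutations_of_multiset_def)
  have "carlitz_psi ` ?S \<subseteq> ?S"
    by (auto simp: permutations_of_multiset_def mset_carlitz_psi)
  then have "carlitz_psi ` ?S = ?S"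
    by (intro endo_inj_surj inj) auto
  with inj have "bij_betw carlitz_psi ?S ?S"
    by (simp add: bij_betw_def)
  then show ?thesis
    by (simp add: Rlmin_carlitz_psi maj_carlitz_psi rlmin_def)
qed

end
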